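(* Let $K$ be an algebraically closed field of characteristic $0$, let $f\in K[x]$, let $p,q\geq 1$ be integers, $n=p+q$, and let $A=\mathrm{diag}(\mu I_p,\lambda I_q)\in M_n(K)$ where $\lambda,\mu$ are distinct elements of $K$. Let $\mathcal{T}=f'(f^{-1}(0))\setminus\{0\}$, i.e. $\mathcal{T}=\{f'(\alpha)\;:\;\alpha\in K,\ f(\alpha)=0\}\setminus\{0\}$. Consider the equation $XA-AX=f(X)$ in the unknown $X\in M_n(K)$. (i) If $\lambda-\mu\notin\mathcal{T}$ and $\mu-\lambda\notin\mathcal{T}$, then any solution $X$ of $XA-AX=f(X)$ satisfies $XA=AX$. (ii) If $\mu-\lambda\notin\mathcal{T}$, then the solutions $X$ of $XA-AX=f(X)$ are of the form $$X=\begin{pmatrix}P&Q\\0_{q,p}&S\end{pmatrix}\quad\text{where } P\in M_p(K),\ S\in M_q(K),\ f(P)=0_p,\ f(S)=0_q,$$ and there exist such solutions that do not commute with $A$ if and only if $\lambda-\mu\in\mathcal{T}$.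
   Context: $M_n(K)$ is the set of $n\times n$ matrices over $K$; $0_p$ is the $p\times p$ zero matrix and $0_{q,p}$ the $q\times p$ zero matrix. The block $Q$ is a $p\times q$ matrix over $K$. *)

theory Defs
  imports
    "HOL-Computational_Algebra.Polynomial"
    "Jordan_Normal_Form.Matrix"
begin

(* The type of matrices of all sizes is not an additive monoid, so the sum over k of
   coeff f k times the k-th power of X is formed entrywise; the constant term contributes
   coeff f 0 times the identity.  Only meaningful for square X. *)
definition poly_mat :: "'a :: comm_ring_1 poly \<Rightarrow> 'a mat \<Rightarrow> 'a mat" where
  "poly_mat f X = mat (dim_row X) (dim_col X)
     (\<lambda>(i, j). \<Sum>k\<le>degree f. coeff f k * (X ^\<^sub>m k) $$ (i, j))"

lemma poly_mat_carrier [simp]: "X \<in> carrier_mat n n \<Longrightarrow> poly_mat f X \<in> carrier_mat n n"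
  by (auto simp: poly_mat_def)

definition nonzero_derivs_at_roots :: "'a :: field_char_0 poly \<Rightarrow> 'a set" where
  "nonzero_derivs_at_roots f = {poly (pderiv f) \<alpha> | \<alpha>. poly f \<alpha> = 0} - {0}"

end

theory Submission
  imports Defs
begin

text \<open>
  The matrix $f(X)$ commutes with $X$, hence so does the commutator $XA - AX$. Write $X$ in blocks
  $P, Q, R, S$ conforming to $A$. The commutator has vanishing diagonal blocks and off-diagonal blocks
  $(\lambda-\mu)Q$ and $(\mu-\lambda)R$, so commuting with $X$ means $QR = -QR$, $RQ = -RQ$,
  $PQ = QS$ and $SR = RP$; characteristic $0$ gives $QR = 0$ and $RQ = 0$. Therefore $X$ is the
  sum of the block-diagonal matrix $\mathrm{diag}(P,S)$ and of a matrix of square zero commuting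
  with it, and the Taylor expansion of $f$ stops at first order
  (\<open>poly_mat_four_block_mat\<close>):
  the blocks of $f(X)$ are $f(P)$, $f'(P)Q$, $f'(S)R$, $f(S)$. The equation thus becomes
  $f(P) = 0$, $f(S) = 0$, $f'(P)Q = (\lambda-\mu)Q$, $f'(S)R = (\mu-\lambda)R$
  (\<open>commutator_equation_blocks\<close>).

  If $Q \neq 0$, then $\lambda-\mu$ is an eigenvalue of $f'(P)$ where $f(P) = 0$. Multiplying $Q$
  by the linear factors of $f$ at $P$ one after the other, and stopping just before it is killed,
  yields a common eigenvector of $P$ and $f'(P)$ (\<open>poly_mat_common_root\<close>), so
  $\lambda-\mu = f'(\alpha)$ for a root $\alpha$ of $f$. In the same way $R \neq 0$ forces
  $\mu-\lambda = f'(\alpha)$ for a root $\alpha$. Conversely, for a root $\alpha$ of $f$ with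
  $f'(\alpha) = \lambda-\mu$, the choice $P = \alpha I_p$, $S = \alpha I_q$, $R = 0$ and
  any $Q \neq 0$ is a solution that does not commute with $A$.
\<close>

section \<open>Polynomials evaluated at a matrix\<close>

lemma poly_mat_dim [simp]: "dim_row (poly_mat f X) = dim_row X" "dim_col (poly_mat f X) = dim_col X"
  by (simp_all add: poly_mat_def)

lemma poly_mat_index:
  assumes "degree f \<le> N" "i < dim_row X" "j < dim_col X"
  shows "poly_mat f X $$ (i, j) = (\<Sum>k\<le>N. coeff f k * (X ^\<^sub>m k) $$ (i, j))"
proof -
  have "(\<Sum>k\<le>degree f. coeff f k * (X ^\<^sub>m k) $$ (i, j))
      = (\<Sum>k\<le>N. coeff f k * (X ^\<^sub>m k) $$ (i, j))"
    by (rule sum.mono_neutral_left) (use assms in \<open>auto simp: coeff_eq_0\<close>)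
  then show ?thesis using assms by (simp add: poly_mat_def)
qed

lemma poly_mat_0 [simp]: "X \<in> carrier_mat n n \<Longrightarrow> poly_mat 0 X = 0\<^sub>m n n"
  by (rule eq_matI) (auto simp: poly_mat_def)

lemma poly_mat_add:
  assumes X: "X \<in> carrier_mat n n"
  shows "poly_mat (f + g) X = poly_mat f X + poly_mat g X"
proof (rule eq_matI)
  fix i j assume "i < dim_row (poly_mat f X + poly_mat g X)" "j < dim_col (poly_mat f X + poly_mat g X)"
  then show "poly_mat (f + g) X $$ (i, j) = (poly_mat f X + poly_mat g X) $$ (i, j)"
    using X poly_mat_index[of _ "max (degree f) (degree g)" i X j]
    by (simp add: degree_add_le_max algebra_simps sum.distrib)
qed (use X in auto)

lemma poly_mat_smult:
  assumes X: "X \<in> carrier_mat n n"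
  shows "poly_mat (Polynomial.smult c f) X = c \<cdot>\<^sub>m poly_mat f X"
proof (rule eq_matI)
  fix i j assume "i < dim_row (c \<cdot>\<^sub>m poly_mat f X)" "j < dim_col (c \<cdot>\<^sub>m poly_mat f X)"
  then show "poly_mat (Polynomial.smult c f) X $$ (i, j) = (c \<cdot>\<^sub>m poly_mat f X) $$ (i, j)"
    using X poly_mat_index[of _ "degree f" i X j]
    by (simp add: degree_smult_le sum_distrib_left mult.assoc)
qed (use X in auto)

text \<open>Horner's rule. With it, statements about \<^const>\<open>poly_mat\<close> go by induction on the polynomial.\<close>

lemma poly_mat_pCons:
  assumes X: "X \<in> carrier_mat n n"
  shows "poly_mat (pCons a g) X = a \<cdot>\<^sub>m 1\<^sub>m n + poly_mat g X * X"
proof (rule eq_matI)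
  fix i j
  assume "i < dim_row (a \<cdot>\<^sub>m 1\<^sub>m n + poly_mat g X * X)" "j < dim_col (a \<cdot>\<^sub>m 1\<^sub>m n + poly_mat g X * X)"
  then have ij: "i < n" "j < n" using X by auto
  let ?N = "degree g"
  have pow: "(X ^\<^sub>m k) \<in> carrier_mat n n" for k using X by simp
  have "poly_mat (pCons a g) X $$ (i, j)
      = (\<Sum>k\<le>Suc ?N. coeff (pCons a g) k * (X ^\<^sub>m k) $$ (i, j))"
    by (rule poly_mat_index) (use X ij in \<open>auto simp: degree_pCons_le\<close>)
  also have "\<dots> = a * (1\<^sub>m n) $$ (i, j) + (\<Sum>k\<le>?N. coeff g k * (X ^\<^sub>m k * X) $$ (i, j))"
    using X by (subst sum.atMost_Suc_shift) simp
  also have "(\<Sum>k\<le>?N. coeff g k * (X ^\<^sub>m k * X) $$ (i, j))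
      = (\<Sum>k\<le>?N. \<Sum>l<n. coeff g k * (X ^\<^sub>m k) $$ (i, l) * X $$ (l, j))"
    using X ij pow[THEN carrier_matD(1)] pow[THEN carrier_matD(2)]
    by (simp add: scalar_prod_def sum_distrib_left mult.assoc atLeast0LessThan)
  also have "\<dots> = (\<Sum>l<n. (\<Sum>k\<le>?N. coeff g k * (X ^\<^sub>m k) $$ (i, l)) * X $$ (l, j))"
    by (subst sum.swap) (simp add: sum_distrib_right)
  also have "\<dots> = (\<Sum>l<n. poly_mat g X $$ (i, l) * X $$ (l, j))"
    using X ij by (intro sum.cong) (auto simp: poly_mat_def)
  also have "\<dots> = (poly_mat g X * X) $$ (i, j)"
    using X ij by (simp add: scalar_prod_def atLeast0LessThan)
  finally show "poly_mat (pCons a g) X $$ (i, j) = (a \<cdot>\<^sub>m 1\<^sub>m n + poly_mat g X * X) $$ (i, j)"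
    using X ij by simp
qed (use X in auto)

lemma poly_mat_intertwine:
  assumes P: "P \<in> carrier_mat p p" and S: "S \<in> carrier_mat q q" and W: "W \<in> carrier_mat p q"
    and PW: "P * W = W * S"
  shows "poly_mat f P * W = W * poly_mat f S"
proof (induction f)
  case 0
  then show ?case using assms by simp
next
  case (pCons a f)
  have fP: "poly_mat f P \<in> carrier_mat p p" and fS: "poly_mat f S \<in> carrier_mat q q"
    using P S by auto
  have "poly_mat (pCons a f) P * W = (a \<cdot>\<^sub>m 1\<^sub>m p) * W + (poly_mat f P * P) * W"
    unfolding poly_mat_pCons[OF P] by (rule add_mult_distrib_mat) (use P W fP in auto)
  also have "(poly_mat f P * P) * W = (poly_mat f P * W) * S"
    using assoc_mult_mat[OF fP P W] assoc_mult_mat[OF fP W S] PW by simp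
  also have "\<dots> = W * (poly_mat f S * S)"
    using pCons.IH assoc_mult_mat[OF W fS S] by simp
  also have "(a \<cdot>\<^sub>m 1\<^sub>m p) * W = W * (a \<cdot>\<^sub>m 1\<^sub>m q)"
    using W mult_smult_assoc_mat[OF one_carrier_mat W] mult_smult_distrib[OF W one_carrier_mat] by simp
  also have "W * (a \<cdot>\<^sub>m 1\<^sub>m q) + W * (poly_mat f S * S) = W * poly_mat (pCons a f) S"
    unfolding poly_mat_pCons[OF S] by (rule mult_add_distrib_mat[symmetric]) (use S W fS in auto)
  finally show ?case .
qed

lemma poly_mat_scalar: "poly_mat f (c \<cdot>\<^sub>m 1\<^sub>m n) = poly f c \<cdot>\<^sub>m 1\<^sub>m n"
proof (induction f)
  case 0
  show ?case by (rule eq_matI) (auto simp: poly_mat_def)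
next
  case (pCons a f)
  have "(poly f c \<cdot>\<^sub>m 1\<^sub>m n) * (c \<cdot>\<^sub>m 1\<^sub>m n) = (c * poly f c) \<cdot>\<^sub>m 1\<^sub>m n"
    by (subst mult_smult_distrib[of _ n n _ n]) auto
  then show ?case
    using pCons by (simp add: poly_mat_pCons[of _ n] add_smult_distrib_right_mat[of _ n n])
qed

lemma poly_mat_linear_factor:
  assumes X: "X \<in> carrier_mat n n"
  shows "poly_mat ([:- c, 1:] * g) X = poly_mat g X * (X - c \<cdot>\<^sub>m 1\<^sub>m n)"
proof -
  have g: "poly_mat g X \<in> carrier_mat n n" using X by simp
  have "poly_mat ([:- c, 1:] * g) X = poly_mat (Polynomial.smult (- c) g + pCons 0 g) X"
    by simp
  also have "\<dots> = (- c) \<cdot>\<^sub>m poly_mat g X + (0 \<cdot>\<^sub>m 1\<^sub>m n + poly_mat g X * X)"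
    using X by (simp only: poly_mat_add[OF X] poly_mat_smult[OF X] poly_mat_pCons[OF X])
  also have "\<dots> = poly_mat g X * X - c \<cdot>\<^sub>m poly_mat g X"
    using X g by (intro eq_matI) auto
  also have "c \<cdot>\<^sub>m poly_mat g X = poly_mat g X * (c \<cdot>\<^sub>m 1\<^sub>m n)"
    using mult_smult_distrib[OF g one_carrier_mat] right_mult_one_mat[OF g] by simp
  also have "poly_mat g X * X - poly_mat g X * (c \<cdot>\<^sub>m 1\<^sub>m n) = poly_mat g X * (X - c \<cdot>\<^sub>m 1\<^sub>m n)"
    by (rule mult_minus_distrib_mat[symmetric]) (use X g in auto)
  finally show ?thesis .
qed

text \<open>
  The columns of $W$ are killed by $g(P)$ and satisfy $h(P)w = dw$. As long as $W$ is not killed by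
  $P - \alpha I$, where $\alpha$ is a root of $g$, it can be replaced by $(P - \alpha I)W$ and $g$ by
  $g/(x-\alpha)$. When it is killed, its nonzero columns are eigenvectors of $P$ for $\alpha$, and
  $h(\alpha) = d$. Working with $W$ as a whole instead of with single columns lets the blocks of the
  equation be plugged in directly.
\<close>

lemma poly_mat_common_root:
  fixes g h :: "'a :: alg_closed_field poly"
  assumes P: "P \<in> carrier_mat p p" and W: "W \<in> carrier_mat p q" "W \<noteq> 0\<^sub>m p q"
    and g: "g \<noteq> 0" "poly_mat g P * W = 0\<^sub>m p q"
    and h: "poly_mat h P * W = d \<cdot>\<^sub>m W"
  shows "\<exists>\<alpha>. poly g \<alpha> = 0 \<and> poly h \<alpha> = d"
  using W g h
proof (induction "degree g" arbitrary: g W)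
  case 0
  then obtain c where c: "g = [:c:]" "c \<noteq> 0"
    by (metis degree_eq_zeroE pCons_0_0)
  have "poly_mat g P = c \<cdot>\<^sub>m 1\<^sub>m p"
    using P unfolding c(1) poly_mat_pCons[OF P] by (intro eq_matI) auto
  then have "c \<cdot>\<^sub>m W = 0\<^sub>m p q"
    using 0 P mult_smult_assoc_mat[OF one_carrier_mat \<open>W \<in> carrier_mat p q\<close>] by simp
  moreover have "(1 / c) \<cdot>\<^sub>m (c \<cdot>\<^sub>m W) = W"
    using c(2) by (intro eq_matI) auto
  ultimately show ?case using \<open>W \<noteq> 0\<^sub>m p q\<close> by simp
next
  case (Suc k)
  then obtain \<alpha> where \<alpha>: "poly g \<alpha> = 0"
    by (metis alg_closed_imp_poly_has_root zero_less_Suc)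
  then obtain g1 where g1: "g = [:- \<alpha>, 1:] * g1"
    by (meson dvdE poly_eq_0_iff_dvd)
  have "g1 \<noteq> 0" using Suc.prems g1 by auto
  then have k: "k = degree g1"
    using Suc.hyps(2) unfolding g1 by (subst (asm) degree_mult_eq) auto
  note W = \<open>W \<in> carrier_mat p q\<close>
  define L where "L = P - \<alpha> \<cdot>\<^sub>m 1\<^sub>m p"
  have L: "L \<in> carrier_mat p p" unfolding L_def by (rule minus_carrier_mat) simp
  have hP: "poly_mat h P \<in> carrier_mat p p" and g1P: "poly_mat g1 P \<in> carrier_mat p p"
    using P by auto
  have LW: "L * W = P * W - \<alpha> \<cdot>\<^sub>m W"
  proof -
    have "L * W = P * W - (\<alpha> \<cdot>\<^sub>m 1\<^sub>m p) * W"
      unfolding L_def by (rule minus_mult_distrib_mat) (use P W in auto)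
    then show ?thesis using W mult_smult_assoc_mat[OF one_carrier_mat W] by simp
  qed
  show ?case
  proof (cases "L * W = 0\<^sub>m p q")
    case True
    have "P * W = W * (\<alpha> \<cdot>\<^sub>m 1\<^sub>m q)"
    proof -
      have "P * W = (P * W - \<alpha> \<cdot>\<^sub>m W) + \<alpha> \<cdot>\<^sub>m W"
        using P W by (intro eq_matI) auto
      also have "\<dots> = \<alpha> \<cdot>\<^sub>m W"
        using True W unfolding LW by simp
      finally show ?thesis using W mult_smult_distrib[OF W one_carrier_mat] by simp
    qed
    then have "poly_mat h P * W = W * poly_mat h (\<alpha> \<cdot>\<^sub>m 1\<^sub>m q)"
      by (intro poly_mat_intertwine[OF P _ W]) auto
    then have eq: "d \<cdot>\<^sub>m W = poly h \<alpha> \<cdot>\<^sub>m W"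
      using Suc.prems W mult_smult_distrib[OF W one_carrier_mat] by (simp add: poly_mat_scalar)
    obtain i j where ij: "i < p" "j < q" "W $$ (i, j) \<noteq> 0"
    proof (rule ccontr)
      assume "\<not> thesis"
      with that have "W = 0\<^sub>m p q" using W by (intro eq_matI) auto
      with Suc.prems show False by simp
    qed
    have "d * W $$ (i, j) = poly h \<alpha> * W $$ (i, j)"
      using arg_cong[OF eq, of "\<lambda>M. M $$ (i, j)"] ij W by simp
    then have "poly h \<alpha> = d" using ij by simp
    with \<alpha> show ?thesis by blast
  next
    case False
    have "L * W \<in> carrier_mat p q" using L W by simp
    moreover have "poly_mat g1 P * (L * W) = 0\<^sub>m p q"
      using Suc.prems(4) assoc_mult_mat[OF g1P L W] poly_mat_linear_factor[OF P, of \<alpha> g1]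
      unfolding g1 L_def by simp
    moreover have "poly_mat h P * (L * W) = d \<cdot>\<^sub>m (L * W)"
    proof -
      have "P * L = L * P"
        using P minus_mult_distrib_mat[OF P _ P, of "\<alpha> \<cdot>\<^sub>m 1\<^sub>m p"]
          mult_minus_distrib_mat[OF P P, of "\<alpha> \<cdot>\<^sub>m 1\<^sub>m p"]
          mult_smult_assoc_mat[OF one_carrier_mat P] mult_smult_distrib[OF P one_carrier_mat]
        by (simp add: L_def)
      then have "poly_mat h P * L = L * poly_mat h P"
        by (rule poly_mat_intertwine[OF P P L])
      then have "poly_mat h P * (L * W) = L * (poly_mat h P * W)"
        using assoc_mult_mat[OF hP L W] assoc_mult_mat[OF L hP W] by simp
      then show ?thesis using Suc.prems mult_smult_distrib[OF L W] by simp
    qed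
    ultimately obtain \<beta> where "poly g1 \<beta> = 0 \<and> poly h \<beta> = d"
      using Suc.hyps(1)[OF k _ False \<open>g1 \<noteq> 0\<close>] by blast
    then show ?thesis unfolding g1 by auto
  qed
qed

section \<open>Block matrices\<close>

lemma four_block_mat_eqD:
  assumes c: "P \<in> carrier_mat p p'" "Q \<in> carrier_mat p q'" "R \<in> carrier_mat q p'" "S \<in> carrier_mat q q'"
    and c': "P' \<in> carrier_mat p p'" "Q' \<in> carrier_mat p q'" "R' \<in> carrier_mat q p'" "S' \<in> carrier_mat q q'"
    and eq: "four_block_mat P Q R S = four_block_mat P' Q' R' S'"
  shows "P = P'" "Q = Q'" "R = R'" "S = S'"
proof -
  have e: "four_block_mat P Q R S $$ (i, j) = four_block_mat P' Q' R' S' $$ (i, j)" for i j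
    using eq by simp
  show "P = P'"
  proof (rule eq_matI)
    fix i j assume "i < dim_row P'" "j < dim_col P'"
    then show "P $$ (i, j) = P' $$ (i, j)" using c c' e[of i j] by auto
  qed (use c c' in auto)
  show "Q = Q'"
  proof (rule eq_matI)
    fix i j assume "i < dim_row Q'" "j < dim_col Q'"
    then show "Q $$ (i, j) = Q' $$ (i, j)" using c c' e[of i "p' + j"] by auto
  qed (use c c' in auto)
  show "R = R'"
  proof (rule eq_matI)
    fix i j assume "i < dim_row R'" "j < dim_col R'"
    then show "R $$ (i, j) = R' $$ (i, j)" using c c' e[of "p + i" j] by auto
  qed (use c c' in auto)
  show "S = S'"
  proof (rule eq_matI)
    fix i j assume "i < dim_row S'" "j < dim_col S'"
    then show "S $$ (i, j) = S' $$ (i, j)" using c c' e[of "p + i" "p' + j"] by auto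
  qed (use c c' in auto)
qed

text \<open>
  First-order Taylor formula: the off-diagonal part of the matrix has square zero and commutes with
  the diagonal part.
\<close>

lemma poly_mat_four_block_mat:
  fixes P :: "'a :: idom mat"
  assumes P: "P \<in> carrier_mat p p" and Q: "Q \<in> carrier_mat p q"
    and R: "R \<in> carrier_mat q p" and S: "S \<in> carrier_mat q q"
    and PQ: "P * Q = Q * S" and SR: "S * R = R * P"
    and QR: "Q * R = 0\<^sub>m p p" and RQ: "R * Q = 0\<^sub>m q q"
  shows "poly_mat f (four_block_mat P Q R S)
    = four_block_mat (poly_mat f P) (poly_mat (pderiv f) P * Q)
        (poly_mat (pderiv f) S * R) (poly_mat f S)"
proof (induction f)
  case 0
  then show ?case using P Q R S by (simp add: poly_mat_0[of _ "p + q"])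
next
  case (pCons a f)
  let ?X = "four_block_mat P Q R S"
  \<comment> \<open>The product rule $(a + xf)' = f + xf'$, in the form needed for both off-diagonal blocks.\<close>
  have deriv_step: "poly_mat f U * V + (poly_mat (pderiv f) U * V) * W = poly_mat (pderiv (pCons a f)) U * V"
    if U: "U \<in> carrier_mat u u" and V: "V \<in> carrier_mat u v" and W: "W \<in> carrier_mat v v"
      and UV: "U * V = V * W" for U V W :: "'a mat" and u v
  proof -
    have c: "poly_mat f U \<in> carrier_mat u u" "poly_mat (pderiv f) U \<in> carrier_mat u u"
      using U by auto
    have "0 \<cdot>\<^sub>m 1\<^sub>m u = (0\<^sub>m u u :: 'a mat)"
      by (intro eq_matI) auto
    then have "poly_mat (pderiv (pCons a f)) U = poly_mat f U + poly_mat (pderiv f) U * U"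
      using U c left_add_zero_mat[OF mult_carrier_mat[OF c(2) U]]
      by (simp add: pderiv_pCons poly_mat_add[OF U] poly_mat_pCons[OF U])
    then have "poly_mat (pderiv (pCons a f)) U * V
        = poly_mat f U * V + (poly_mat (pderiv f) U * U) * V"
      using add_mult_distrib_mat[OF c(1) _ V, of "poly_mat (pderiv f) U * U"] c U by simp
    also have "(poly_mat (pderiv f) U * U) * V = (poly_mat (pderiv f) U * V) * W"
      using assoc_mult_mat[OF c(2) U V] assoc_mult_mat[OF c(2) V W] UV by simp
    finally show ?thesis by simp
  qed
  have fP: "poly_mat f P \<in> carrier_mat p p" "poly_mat (pderiv f) P \<in> carrier_mat p p"
    and fS: "poly_mat f S \<in> carrier_mat q q" "poly_mat (pderiv f) S \<in> carrier_mat q q"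
    using P S by auto
  have X: "?X \<in> carrier_mat (p + q) (p + q)" using P S by simp
  have "poly_mat (pCons a f) ?X = a \<cdot>\<^sub>m 1\<^sub>m (p + q)
      + four_block_mat (poly_mat f P) (poly_mat (pderiv f) P * Q)
        (poly_mat (pderiv f) S * R) (poly_mat f S) * ?X"
    by (simp only: poly_mat_pCons[OF X] pCons.IH)
  also have "four_block_mat (poly_mat f P) (poly_mat (pderiv f) P * Q)
        (poly_mat (pderiv f) S * R) (poly_mat f S) * ?X
      = four_block_mat
          (poly_mat f P * P + (poly_mat (pderiv f) P * Q) * R)
          (poly_mat f P * Q + (poly_mat (pderiv f) P * Q) * S)
          ((poly_mat (pderiv f) S * R) * P + poly_mat f S * R)
          ((poly_mat (pderiv f) S * R) * Q + poly_mat f S * S)"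
    by (rule mult_four_block_mat) (use P Q R S fP fS in auto)
  also have "poly_mat f P * Q + (poly_mat (pderiv f) P * Q) * S = poly_mat (pderiv (pCons a f)) P * Q"
    by (rule deriv_step[OF P Q S PQ])
  also have "(poly_mat (pderiv f) S * R) * P + poly_mat f S * R
      = poly_mat f S * R + (poly_mat (pderiv f) S * R) * P"
    by (rule comm_add_mat) (use P R fS in auto)
  also have "\<dots> = poly_mat (pderiv (pCons a f)) S * R"
    by (rule deriv_step[OF S R P SR])
  also have "poly_mat f P * P + (poly_mat (pderiv f) P * Q) * R = poly_mat f P * P"
    using assoc_mult_mat[OF fP(2) Q R] QR right_mult_zero_mat[OF fP(2)]
      right_add_zero_mat[OF mult_carrier_mat[OF fP(1) P]]
    by simp
  also have "(poly_mat (pderiv f) S * R) * Q + poly_mat f S * S = poly_mat f S * S"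
    using assoc_mult_mat[OF fS(2) R Q] RQ right_mult_zero_mat[OF fS(2)]
      left_add_zero_mat[OF mult_carrier_mat[OF fS(1) S]]
    by simp
  also have "a \<cdot>\<^sub>m 1\<^sub>m (p + q) = four_block_mat (a \<cdot>\<^sub>m 1\<^sub>m p) (0\<^sub>m p q) (0\<^sub>m q p) (a \<cdot>\<^sub>m (1\<^sub>m q :: 'a mat))"
    by (intro eq_matI) auto
  finally show ?case
    using P Q R S fP fS
    by (subst (asm) add_four_block_mat[of _ p p _ q _ q])
       (auto simp: poly_mat_pCons[OF P] poly_mat_pCons[OF S])
qed

section \<open>The commutator equation\<close>

lemma commutator_diag_four_block_mat:
  fixes lam mu :: "'a :: comm_ring_1"
  assumes P: "P \<in> carrier_mat p p" and Q: "Q \<in> carrier_mat p q"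
    and R: "R \<in> carrier_mat q p" and S: "S \<in> carrier_mat q q"
    and X: "X = four_block_mat P Q R S"
    and A: "A = four_block_mat (mu \<cdot>\<^sub>m 1\<^sub>m p) (0\<^sub>m p q) (0\<^sub>m q p) (lam \<cdot>\<^sub>m 1\<^sub>m q)"
  shows "X * A - A * X
    = four_block_mat (0\<^sub>m p p) ((lam - mu) \<cdot>\<^sub>m Q) ((mu - lam) \<cdot>\<^sub>m R) (0\<^sub>m q q)"
proof -
  have right: "M * (c \<cdot>\<^sub>m 1\<^sub>m v) = c \<cdot>\<^sub>m M" if "M \<in> carrier_mat u v" for c u v and M :: "'a mat"
    using that mult_smult_distrib[OF that one_carrier_mat] by simp
  have left: "(c \<cdot>\<^sub>m 1\<^sub>m u) * M = c \<cdot>\<^sub>m M" if "M \<in> carrier_mat u v" for c u v and M :: "'a mat"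
    using that mult_smult_assoc_mat[OF one_carrier_mat that] by simp
  have "X * A = four_block_mat (mu \<cdot>\<^sub>m P) (lam \<cdot>\<^sub>m Q) (mu \<cdot>\<^sub>m R) (lam \<cdot>\<^sub>m S)"
    unfolding X A using P Q R S
    by (subst mult_four_block_mat[of _ p p _ q _ q _ _ p _ q]) (auto simp: right)
  moreover have "A * X = four_block_mat (mu \<cdot>\<^sub>m P) (mu \<cdot>\<^sub>m Q) (lam \<cdot>\<^sub>m R) (lam \<cdot>\<^sub>m S)"
    unfolding X A using P Q R S
    by (subst mult_four_block_mat[of _ p p _ q _ q _ _ p _ q]) (auto simp: left)
  ultimately show ?thesis
    using P Q R S by (intro eq_matI) (auto simp: algebra_simps)
qed

lemma commutator_equation_blocks:
  fixes lam mu :: "'a :: field_char_0"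
  assumes P: "P \<in> carrier_mat p p" and Q: "Q \<in> carrier_mat p q"
    and R: "R \<in> carrier_mat q p" and S: "S \<in> carrier_mat q q"
    and X: "X = four_block_mat P Q R S"
    and A: "A = four_block_mat (mu \<cdot>\<^sub>m 1\<^sub>m p) (0\<^sub>m p q) (0\<^sub>m q p) (lam \<cdot>\<^sub>m 1\<^sub>m q)"
    and neq: "lam \<noteq> mu"
    and eq: "X * A - A * X = poly_mat f X"
  shows "poly_mat f P = 0\<^sub>m p p" "poly_mat f S = 0\<^sub>m q q"
    "poly_mat (pderiv f) P * Q = (lam - mu) \<cdot>\<^sub>m Q" "poly_mat (pderiv f) S * R = (mu - lam) \<cdot>\<^sub>m R"
proof -
  let ?d = "lam - mu"
  have d: "?d \<noteq> 0" using neq by simp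
  have cancel: "M = N" if "?d \<cdot>\<^sub>m M = ?d \<cdot>\<^sub>m N" for M N :: "'a mat"
  proof -
    have "(1 / ?d) \<cdot>\<^sub>m (?d \<cdot>\<^sub>m M) = M" "(1 / ?d) \<cdot>\<^sub>m (?d \<cdot>\<^sub>m N) = N"
      using d by (intro eq_matI; simp)+
    with that show ?thesis by metis
  qed
  have neg: "(mu - lam) \<cdot>\<^sub>m M = - (?d \<cdot>\<^sub>m M)" for M :: "'a mat"
    by (intro eq_matI) (auto simp: algebra_simps)
  \<comment> \<open>This is where characteristic $0$ enters, through $2 \neq 0$.\<close>
  have uminus_cancel: "M = 0\<^sub>m u v" if "M \<in> carrier_mat u v" "M = - M" for M :: "'a mat" and u v
  proof (rule eq_matI)
    fix i j assume "i < dim_row (0\<^sub>m u v :: 'a mat)" "j < dim_col (0\<^sub>m u v :: 'a mat)"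
    then have ij: "i < u" "j < v" by auto
    have "M $$ (i, j) = (- M) $$ (i, j)"
      using that(2) by (rule arg_cong)
    then have "2 * M $$ (i, j) = 0"
      using that(1) ij by (simp add: eq_neg_iff_add_eq_0)
    then show "M $$ (i, j) = 0\<^sub>m u v $$ (i, j)"
      using ij by simp
  qed (use that in auto)
  have comm: "poly_mat f X = four_block_mat (0\<^sub>m p p) (?d \<cdot>\<^sub>m Q) (- (?d \<cdot>\<^sub>m R)) (0\<^sub>m q q)"
    using commutator_diag_four_block_mat[OF P Q R S X A] eq by (simp add: neg)
  have Xc: "X \<in> carrier_mat (p + q) (p + q)" using P S by (simp add: X)
  have XN: "X * poly_mat f X
      = four_block_mat (- (?d \<cdot>\<^sub>m (Q * R))) (?d \<cdot>\<^sub>m (P * Q)) (- (?d \<cdot>\<^sub>m (S * R))) (?d \<cdot>\<^sub>m (R * Q))"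
    unfolding comm unfolding X using P Q R S
    by (subst mult_four_block_mat[of _ p p _ q _ q _ _ p _ q])
       (auto simp: mult_smult_distrib)
  have NX: "poly_mat f X * X
      = four_block_mat (?d \<cdot>\<^sub>m (Q * R)) (?d \<cdot>\<^sub>m (Q * S)) (- (?d \<cdot>\<^sub>m (R * P))) (- (?d \<cdot>\<^sub>m (R * Q)))"
    unfolding comm unfolding X using P Q R S
    by (subst mult_four_block_mat[of _ p p _ q _ q _ _ p _ q])
       (auto simp: mult_smult_assoc_mat uminus_mult_left_mat)
  have "poly_mat f X * X = X * poly_mat f X"
    by (rule poly_mat_intertwine[OF Xc Xc Xc]) simp
  then have blocks: "four_block_mat (- (?d \<cdot>\<^sub>m (Q * R))) (?d \<cdot>\<^sub>m (P * Q)) (- (?d \<cdot>\<^sub>m (S * R))) (?d \<cdot>\<^sub>m (R * Q))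
      = four_block_mat (?d \<cdot>\<^sub>m (Q * R)) (?d \<cdot>\<^sub>m (Q * S)) (- (?d \<cdot>\<^sub>m (R * P))) (- (?d \<cdot>\<^sub>m (R * Q)))"
    unfolding XN NX by simp
  have b: "- (?d \<cdot>\<^sub>m (Q * R)) = ?d \<cdot>\<^sub>m (Q * R)" "?d \<cdot>\<^sub>m (P * Q) = ?d \<cdot>\<^sub>m (Q * S)"
    "- (?d \<cdot>\<^sub>m (S * R)) = - (?d \<cdot>\<^sub>m (R * P))" "?d \<cdot>\<^sub>m (R * Q) = - (?d \<cdot>\<^sub>m (R * Q))"
    using four_block_mat_eqD[OF _ _ _ _ _ _ _ _ blocks, of p p q q] P Q R S by auto
  have PQ: "P * Q = Q * S" using b(2) by (rule cancel)
  have SR: "S * R = R * P" using b(3) cancel uminus_uminus_mat by metis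
  have "?d \<cdot>\<^sub>m (Q * R) = 0\<^sub>m p p"
    using uminus_cancel[of "?d \<cdot>\<^sub>m (Q * R)" p p] b(1) Q R by simp
  then have QR: "Q * R = 0\<^sub>m p p" using cancel[of _ "0\<^sub>m p p"] by simp
  have "?d \<cdot>\<^sub>m (R * Q) = 0\<^sub>m q q"
    using uminus_cancel[of "?d \<cdot>\<^sub>m (R * Q)" q q] b(4) Q R by simp
  then have RQ: "R * Q = 0\<^sub>m q q" using cancel[of _ "0\<^sub>m q q"] by simp
  have fX: "four_block_mat (poly_mat f P) (poly_mat (pderiv f) P * Q)
        (poly_mat (pderiv f) S * R) (poly_mat f S)
      = four_block_mat (0\<^sub>m p p) (?d \<cdot>\<^sub>m Q) ((mu - lam) \<cdot>\<^sub>m R) (0\<^sub>m q q)"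
    using poly_mat_four_block_mat[OF P Q R S PQ SR QR RQ, of f] comm by (simp add: X neg)
  have "poly_mat (pderiv f) P * Q \<in> carrier_mat p q" "poly_mat (pderiv f) S * R \<in> carrier_mat q p"
    using P Q R S mult_carrier_mat by (metis poly_mat_carrier)+
  then show "poly_mat f P = 0\<^sub>m p p" "poly_mat f S = 0\<^sub>m q q"
    "poly_mat (pderiv f) P * Q = ?d \<cdot>\<^sub>m Q" "poly_mat (pderiv f) S * R = (mu - lam) \<cdot>\<^sub>m R"
    using four_block_mat_eqD[OF _ _ _ _ _ _ _ _ fX, of p p q q] P Q R S by auto
qed

lemma eigenvalue_in_nonzero_derivs_at_roots:
  fixes f :: "'a :: {alg_closed_field, field_char_0} poly"
  assumes P: "P \<in> carrier_mat p p" and W: "W \<in> carrier_mat p q" "W \<noteq> 0\<^sub>m p q"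
    and f: "poly_mat f P = 0\<^sub>m p p" and d: "poly_mat (pderiv f) P * W = d \<cdot>\<^sub>m W" "d \<noteq> 0"
  shows "d \<in> nonzero_derivs_at_roots f"
proof -
  \<comment> \<open>Every element is a root of the zero polynomial, but its derivative has no nonzero value.\<close>
  have "f \<noteq> 0"
  proof
    assume "f = 0"
    then have "0\<^sub>m p q = d \<cdot>\<^sub>m W" using d(1) P W by simp
    moreover have "(1 / d) \<cdot>\<^sub>m (d \<cdot>\<^sub>m W) = W" using d(2) by (intro eq_matI) auto
    ultimately have "W = (1 / d) \<cdot>\<^sub>m 0\<^sub>m p q" by simp
    with W(2) show False by simp
  qed
  moreover have "poly_mat f P * W = 0\<^sub>m p q" using f W by simp
  ultimately obtain \<alpha> where "poly f \<alpha> = 0" "poly (pderiv f) \<alpha> = d"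
    using poly_mat_common_root[OF P W _ _ d(1)] by blast
  then show ?thesis using d(2) by (auto simp: nonzero_derivs_at_roots_def)
qed

lemma noncommuting_solution_exists:
  fixes f :: "'a :: field_char_0 poly"
  assumes "p \<ge> 1" "q \<ge> 1" and neq: "lam \<noteq> mu"
    and A: "A = four_block_mat (mu \<cdot>\<^sub>m 1\<^sub>m p) (0\<^sub>m p q) (0\<^sub>m q p) (lam \<cdot>\<^sub>m 1\<^sub>m q)"
    and \<alpha>: "poly f \<alpha> = 0" "poly (pderiv f) \<alpha> = lam - mu"
  shows "\<exists>X \<in> carrier_mat (p + q) (p + q). X * A - A * X = poly_mat f X \<and> X * A \<noteq> A * X"
proof -
  define P :: "'a mat" where "P = \<alpha> \<cdot>\<^sub>m 1\<^sub>m p"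
  define S :: "'a mat" where "S = \<alpha> \<cdot>\<^sub>m 1\<^sub>m q"
  \<comment> \<open>Any nonzero block serves; the all-ones matrix has a nonzero entry at a convenient position.\<close>
  define Q :: "'a mat" where "Q = mat p q (\<lambda>_. 1)"
  define X where "X = four_block_mat P Q (0\<^sub>m q p) S"
  have c: "P \<in> carrier_mat p p" "Q \<in> carrier_mat p q" "0\<^sub>m q p \<in> carrier_mat q p" "S \<in> carrier_mat q q"
    by (simp_all add: P_def Q_def S_def)
  have Xc: "X \<in> carrier_mat (p + q) (p + q)" using c by (simp add: X_def)
  have comm: "X * A - A * X = four_block_mat (0\<^sub>m p p) ((lam - mu) \<cdot>\<^sub>m Q) (0\<^sub>m q p) (0\<^sub>m q q)"
    using commutator_diag_four_block_mat[OF c X_def A] by simp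
  have PQ: "P * Q = Q * S"
    using c(2) mult_smult_assoc_mat[OF one_carrier_mat c(2)] mult_smult_distrib[OF c(2) one_carrier_mat]
    by (simp add: P_def S_def)
  have "poly_mat f X = four_block_mat (poly_mat f P) (poly_mat (pderiv f) P * Q)
      (poly_mat (pderiv f) S * 0\<^sub>m q p) (poly_mat f S)"
    unfolding X_def by (rule poly_mat_four_block_mat) (use c PQ in auto)
  also have "\<dots> = four_block_mat (0\<^sub>m p p) ((lam - mu) \<cdot>\<^sub>m Q) (0\<^sub>m q p) (0\<^sub>m q q)"
    using c(2) mult_smult_assoc_mat[OF one_carrier_mat c(2)] \<alpha>
    by (intro cong_four_block_mat) (auto simp: P_def S_def poly_mat_scalar)
  finally have "X * A - A * X = poly_mat f X" using comm by simp
  moreover have "X * A \<noteq> A * X"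
  proof
    assume "X * A = A * X"
    moreover have "(X * A - A * X) $$ (0, p) = lam - mu"
      unfolding comm using assms(1,2) by (simp add: Q_def)
    ultimately show False using assms(1,2) neq c A Xc by simp
  qed
  ultimately show ?thesis using Xc by blast
qed

theorem proposition1:
  fixes f :: "'a :: {alg_closed_field, field_char_0} poly"
    and p q n :: nat
    and lam mu :: 'a
    and A :: "'a mat"
    and T :: "'a set"
  assumes "p \<ge> 1" and "q \<ge> 1" and "n = p + q"
    and "lam \<noteq> mu"
    and "A = four_block_mat (mu \<cdot>\<^sub>m 1\<^sub>m p) (0\<^sub>m p q) (0\<^sub>m q p) (lam \<cdot>\<^sub>m 1\<^sub>m q)"
    and "T = nonzero_derivs_at_roots f"
  shows
    "(lam - mu \<notin> T \<and> mu - lam \<notin> T \<longrightarrow>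
        (\<forall>X \<in> carrier_mat n n. X * A - A * X = poly_mat f X \<longrightarrow> X * A = A * X))
     \<and>
     (mu - lam \<notin> T \<longrightarrow>
        (\<forall>X \<in> carrier_mat n n. X * A - A * X = poly_mat f X \<longrightarrow>
           (\<exists>P \<in> carrier_mat p p. \<exists>Q \<in> carrier_mat p q. \<exists>S \<in> carrier_mat q q.
              X = four_block_mat P Q (0\<^sub>m q p) S \<and>
              poly_mat f P = 0\<^sub>m p p \<and> poly_mat f S = 0\<^sub>m q q))
        \<and>
        ((\<exists>X \<in> carrier_mat n n. X * A - A * X = poly_mat f X \<and> X * A \<noteq> A * X)
           \<longleftrightarrow> lam - mu \<in> T))"
proof -
  note A = assms(5)
  have neq: "lam \<noteq> mu" by (rule assms(4))
  have solution: "\<exists>P \<in> carrier_mat p p. \<exists>Q \<in> carrier_mat p q. \<exists>R \<in> carrier_mat q p. \<exists>S \<in> carrier_mat q q.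
      X = four_block_mat P Q R S \<and> poly_mat f P = 0\<^sub>m p p \<and> poly_mat f S = 0\<^sub>m q q \<and>
      (Q \<noteq> 0\<^sub>m p q \<longrightarrow> lam - mu \<in> T) \<and> (R \<noteq> 0\<^sub>m q p \<longrightarrow> mu - lam \<in> T)"
    if Xc: "X \<in> carrier_mat n n" and eq: "X * A - A * X = poly_mat f X" for X
  proof -
    obtain P Q R S where split: "split_block X p p = (P, Q, R, S)"
      by (metis prod_cases4)
    have "dim_row X = p + q" "dim_col X = p + q" using Xc \<open>n = p + q\<close> by auto
    note blocks = split_block[OF split this]
    note sol = commutator_equation_blocks[OF blocks A neq eq]
    have "Q \<noteq> 0\<^sub>m p q \<longrightarrow> lam - mu \<in> T"
      using eigenvalue_in_nonzero_derivs_at_roots[OF blocks(1,2) _ sol(1,3)] neq assms(6) by simp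
    moreover have "R \<noteq> 0\<^sub>m q p \<longrightarrow> mu - lam \<in> T"
      using eigenvalue_in_nonzero_derivs_at_roots[OF blocks(4,3) _ sol(2,4)] neq assms(6) by simp
    ultimately show ?thesis using blocks sol by blast
  qed
  have commutes: "X * A = A * X"
    if "P \<in> carrier_mat p p" "S \<in> carrier_mat q q" "X = four_block_mat P (0\<^sub>m p q) (0\<^sub>m q p) S" for X P S
  proof -
    have "X * A - A * X = 0\<^sub>m (p + q) (p + q)"
      using commutator_diag_four_block_mat[OF that(1) _ _ that(2,3) A] by simp
    moreover have "X * A = (X * A - A * X) + A * X"
      using that A by (intro eq_matI) auto
    moreover have "A * X \<in> carrier_mat (p + q) (p + q)"
      using that A by (intro mult_carrier_mat[of _ _ "p + q"] four_block_carrier_mat) auto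
    ultimately show ?thesis by simp
  qed
  have "X * A = A * X"
    if "lam - mu \<notin> T" "mu - lam \<notin> T" "X \<in> carrier_mat n n" "X * A - A * X = poly_mat f X" for X
    using solution[OF that(3,4)] that(1,2) commutes by blast
  moreover have "\<exists>P \<in> carrier_mat p p. \<exists>Q \<in> carrier_mat p q. \<exists>S \<in> carrier_mat q q.
      X = four_block_mat P Q (0\<^sub>m q p) S \<and> poly_mat f P = 0\<^sub>m p p \<and> poly_mat f S = 0\<^sub>m q q"
    if "mu - lam \<notin> T" "X \<in> carrier_mat n n" "X * A - A * X = poly_mat f X" for X
    using solution[OF that(2,3)] that(1) by blast
  moreover have "\<exists>X \<in> carrier_mat n n. X * A - A * X = poly_mat f X \<and> X * A \<noteq> A * X" if root: "lam - mu \<in> T"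
  proof -
    obtain \<alpha> where "poly f \<alpha> = 0" "poly (pderiv f) \<alpha> = lam - mu"
      using root assms(6) by (auto simp: nonzero_derivs_at_roots_def)
    then show ?thesis
      using noncommuting_solution_exists[OF assms(1,2) neq A] \<open>n = p + q\<close> by blast
  qed
  ultimately show ?thesis by blast
qed

end
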